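(* Let $\mathcal G$ be a locally pro-finite group and suppose that $\mathcal G$ has an open pro-$p$ subgroup $\mathcal P$. A smooth $\overline{\mathbf F}_p$-representation $\pi$ of $\mathcal G$ is admissible if and only if $\pi^{\mathcal P}$ is finite dimensional.
   Context: A smooth $\overline{\mathbf F}_p$-representation $\pi$ of $\mathcal G$ (every vector has open stabiliser) is called admissible if for every open subgroup $\mathcal K$ of $\mathcal G$ the space $\pi^{\mathcal K}$ of $\mathcal K$-invariants is finite dimensional over $\overline{\mathbf F}_p$. *)

theory Defs
  imports
    "HOL-Analysis.Abstract_Topological_Spaces"
    "HOL-Algebra.Coset"
    "HOL-Algebra.Group_Action"
    "HOL-Algebra.Algebraic_Closure_Type"
    "Berlekamp_Zassenhaus.Finite_Field"
begin

section \<open>Locally profinite groups and pro-p groups\<close>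

locale topological_group = group G for G (structure) +
  fixes T
  assumes topspace_eq: "topspace T = carrier G"
    and continuous_mult: "continuous_map (prod_topology T T) T (\<lambda>(x, y). x \<otimes> y)"
    and continuous_inv: "continuous_map T T (\<lambda>x. inv x)"

definition totally_disconnected_space :: "'a topology \<Rightarrow> bool" where
  "totally_disconnected_space S \<longleftrightarrow> (\<forall>C. connectedin S C \<longrightarrow> (\<exists>a. C \<subseteq> {a}))"

locale locally_profinite_group = topological_group +
  assumes Hausdorff: "Hausdorff_space T"
    and compact_open_subgroups:
      "\<lbrakk>openin T U; \<one> \<in> U\<rbrakk> \<Longrightarrow> \<exists>K. subgroup K G \<and> openin T K \<and> compactin T K \<and> K \<subseteq> U"

locale profinite_group = topological_group +
  assumes compact: "compact_space T"
    and Hausdorff: "Hausdorff_space T"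
    and totally_disconnected: "totally_disconnected_space T"

text \<open>As \<open>p ^ n\<close> is positive for a prime \<open>p\<close>, the condition on the order includes that the
  quotient is finite.\<close>

locale pro_p_group = profinite_group +
  fixes p :: nat
  assumes prime_p: "prime p"
    and quotient_p_group: "\<lbrakk>N \<lhd> G; openin T N\<rbrakk> \<Longrightarrow> \<exists>n. Coset.order (G Mod N) = p ^ n"


section \<open>Smooth and admissible representations\<close>

locale representation = group_action G UNIV \<pi>
  for G :: "('g, 'm) monoid_scheme" (structure)
    and smul :: "'k::field \<Rightarrow> 'v::ab_group_add \<Rightarrow> 'v" and \<pi> :: "'g \<Rightarrow> 'v \<Rightarrow> 'v" +
  assumes linear: "g \<in> carrier G \<Longrightarrow> Vector_Spaces.linear smul smul (\<pi> g)"

locale smooth_representation = representation +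
  fixes T
  assumes open_stabilizer: "openin T (stabilizer G \<pi> v)"

definition fixed_space :: "('g \<Rightarrow> 'v \<Rightarrow> 'v) \<Rightarrow> 'g set \<Rightarrow> 'v set" where
  "fixed_space \<pi> K = {v. \<forall>k\<in>K. \<pi> k v = v}"

definition finite_dimensional_subspace ::
    "('k::field \<Rightarrow> 'v::ab_group_add \<Rightarrow> 'v) \<Rightarrow> 'v set \<Rightarrow> bool" where
  "finite_dimensional_subspace smul W \<longleftrightarrow> (\<exists>B. finite B \<and> module.span smul B = W)"

definition admissible_representation ::
    "('g, 'm) monoid_scheme \<Rightarrow> ('k::field \<Rightarrow> 'v::ab_group_add \<Rightarrow> 'v) \<Rightarrow>
      ('g \<Rightarrow> 'v \<Rightarrow> 'v) \<Rightarrow> 'g topology \<Rightarrow> bool" where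
  "admissible_representation G smul \<pi> T \<longleftrightarrow> smooth_representation G smul \<pi> T \<and>
    (\<forall>K. subgroup K G \<and> openin T K \<longrightarrow> finite_dimensional_subspace smul (fixed_space \<pi> K))"

text \<open>The prime is encoded as the cardinality of a type \<open>'p\<close> of class \<open>prime_card\<close>, so that
  \<open>'p mod_ring\<close> is the field with \<open>CARD('p)\<close> elements.\<close>

type_synonym 'p Fp_bar = "'p mod_ring alg_closure"

end

theory Submission
  imports Defs
begin

section \<open>Linear algebra in characteristic p\<close>

text \<open>Admissibility gives the condition on \<open>P\<close> at once, because \<open>P\<close>
  is itself open.

  For the other direction, let \<open>N\<close> be a proper open normal subgroup of
  \<open>P\<close>. The quotient of \<open>P\<close> by \<open>N\<close> is a nontrivial finite
  \<open>p\<close>-group, so it has a nontrivial central element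
  (\<open>p_group_exists_central\<close>), represented by some \<open>z\<close> outside
  \<open>N\<close>, and \<open>N\<close> together with \<open>z\<close> generates a strictly larger
  normal subgroup \<open>M\<close>. The operator \<open>z - 1\<close> preserves the
  \<open>N\<close>-fixed vectors, and its kernel there is the space of \<open>M\<close>-fixed
  vectors. If \<open>q\<close> is the index of \<open>N\<close>, a power of \<open>p\<close>, then
  in characteristic \<open>p\<close> the \<open>q\<close>-th power of \<open>z - 1\<close> is that
  of \<open>z\<close> minus 1 (\<open>funpow_prime_power_diff_id\<close>); this vanishes on
  \<open>N\<close>-fixed vectors, since the \<open>q\<close>-th power of \<open>z\<close> lies in
  \<open>N\<close>. A space with a nilpotent operator whose kernel is finite dimensional is finite
  dimensional (\<open>finite_dimensional_subspace_nilpotent\<close>), so finiteness passes from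
  \<open>M\<close> to \<open>N\<close>. Induction on the index carries it from \<open>P\<close> to
  every \<open>N\<close> (\<open>finite_dimensional_fixed_space_normal\<close>).

  For an arbitrary open subgroup \<open>K\<close>, compactness of \<open>P\<close> yields such an
  \<open>N\<close> inside \<open>K \<inter> P\<close> (\<open>exists_open_normal_subgroup\<close>),
  and \<open>K\<close>-fixed vectors are \<open>N\<close>-fixed.\<close>

context vector_space
begin

lemma finite_dimensional_subspace_mono:
  assumes "finite_dimensional_subspace scale V" and "subspace W" and "W \<subseteq> V"
  shows "finite_dimensional_subspace scale W"
proof -
  obtain F where F: "finite F" "span F = V"
    using assms(1) by (auto simp: finite_dimensional_subspace_def)
  obtain B where B: "B \<subseteq> W" "independent B" "W \<subseteq> span B"
    using maximal_independent_subset by metis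
  have "B \<subseteq> span F"
    using B(1) assms(3) F(2) by simp
  then have "finite B"
    using independent_span_bound[OF F(1) B(2)] by blast
  moreover have "span B = W"
    using span_subspace[OF B(1,3) assms(2)] .
  ultimately show ?thesis
    by (auto simp: finite_dimensional_subspace_def)
qed

text \<open>Lifts to \<open>W\<close> of a finite spanning set of the image, together with a finite
  spanning set of the kernel, span \<open>W\<close>: subtracting a combination of the lifts moves
  any \<open>w\<close> into the kernel.\<close>

lemma finite_dimensional_subspace_rank_nullity:
  assumes lin: "Vector_Spaces.linear scale scale f" and W: "subspace W"
    and im: "finite_dimensional_subspace scale (f ` W)"
    and ker: "finite_dimensional_subspace scale {w \<in> W. f w = 0}"
  shows "finite_dimensional_subspace scale W"
proof -
  interpret f: Vector_Spaces.linear scale scale f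
    by (fact lin)
  obtain C where C: "finite C" "span C = f ` W"
    using im by (auto simp: finite_dimensional_subspace_def)
  obtain D where D: "finite D" "span D = {w \<in> W. f w = 0}"
    using ker by (auto simp: finite_dimensional_subspace_def)
  have "C \<subseteq> f ` W"
    using C(2) span_superset by blast
  then obtain L where L: "L \<subseteq> W" "finite L" "C = f ` L"
    using finite_subset_image[OF C(1)] by metis
  have DW: "D \<subseteq> W"
    using D(2) span_superset by blast
  have "W \<subseteq> span (L \<union> D)"
  proof
    fix w assume w: "w \<in> W"
    then have "f w \<in> f ` span L"
      using C(2) L(3) f.span_image by blast
    then obtain u where u: "u \<in> span L" "f w = f u"
      by blast
    have "u \<in> W"
      using u(1) L(1) W span_minimal by blast
    then have "w - u \<in> span D"
      using D(2) w u(2) W by (simp add: subspace_diff f.diff)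
    then have "u + (w - u) \<in> span (L \<union> D)"
      using u(1) by (intro span_add) (meson span_mono Un_upper1 Un_upper2 subsetD)+
    then show "w \<in> span (L \<union> D)"
      by simp
  qed
  then have "span (L \<union> D) = W"
    using L(1) DW W by (intro span_subspace) auto
  then show ?thesis
    using L(2) D(1) unfolding finite_dimensional_subspace_def by blast
qed

section \<open>Nilpotent operators with finite-dimensional kernel\<close>

lemma linear_funpow:
  assumes "Vector_Spaces.linear scale scale f"
  shows "Vector_Spaces.linear scale scale (f ^^ n)"
proof (induction n)
  case 0
  then show ?case
    using linear_id by (simp add: id_def)
next
  case (Suc n)
  from Vector_Spaces.linear_compose[OF this assms] show ?case
    by (simp only: funpow.simps)
qed

text \<open>The kernels \<open>K j\<close> of the powers of \<open>f\<close> on \<open>W\<close>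
  rise from 0 to \<open>W\<close>. Since \<open>f\<close> maps \<open>K (Suc j)\<close> into
  \<open>K j\<close> with the given kernel, each stage inherits finite dimension from the one
  before.\<close>

lemma finite_dimensional_subspace_nilpotent:
  assumes lin: "Vector_Spaces.linear scale scale f" and W: "subspace W"
    and inv: "\<And>w. w \<in> W \<Longrightarrow> f w \<in> W"
    and ker: "finite_dimensional_subspace scale {w \<in> W. f w = 0}"
    and nil: "\<And>w. w \<in> W \<Longrightarrow> (f ^^ n) w = 0"
  shows "finite_dimensional_subspace scale W"
proof -
  interpret f: Vector_Spaces.linear scale scale f
    by (fact lin)
  define K where "K j = {w \<in> W. (f ^^ j) w = 0}" for j
  have lin_pow: "Vector_Spaces.linear scale scale (f ^^ j)" for j
    using lin by (rule linear_funpow)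
  have pow_0: "(f ^^ j) 0 = 0" for j
    by (induction j) (simp_all add: f.zero)
  have sub: "subspace (K j)" for j
  proof -
    interpret fj: Vector_Spaces.linear scale scale "f ^^ j"
      by (fact lin_pow)
    show ?thesis
      using W unfolding K_def subspace_def by (auto simp: fj.add fj.scale)
  qed
  have "finite_dimensional_subspace scale (K j)" for j
  proof (induction j)
    case 0
    have "span {} = K 0"
      using W by (auto simp: K_def subspace_0)
    then show ?case
      unfolding finite_dimensional_subspace_def by blast
  next
    case (Suc j)
    show ?case
    proof (rule finite_dimensional_subspace_rank_nullity[OF lin sub])
      have "f ` K (Suc j) \<subseteq> K j"
        using inv by (auto simp: K_def funpow_swap1)
      then show "finite_dimensional_subspace scale (f ` K (Suc j))"
        using finite_dimensional_subspace_mono[OF Suc] f.subspace_image[OF sub] by blast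
      have "{w \<in> K (Suc j). f w = 0} = {w \<in> W. f w = 0}"
        using pow_0 by (auto simp: K_def funpow_swap1)
      then show "finite_dimensional_subspace scale {w \<in> K (Suc j). f w = 0}"
        using ker by simp
    qed
  qed
  moreover have "K n = W"
    using nil by (auto simp: K_def)
  ultimately show ?thesis
    by metis
qed

section \<open>Powers of f - 1 in characteristic p\<close>

text \<open>This is the binomial theorem for the commuting operators \<open>f\<close> and 1.
  Expanding \<open>f + 1\<close> and later substituting \<open>f - 1\<close> for \<open>f\<close>
  avoids alternating signs, so \<open>p = 2\<close> is no special case.\<close>

lemma funpow_add_id:
  assumes lin: "Vector_Spaces.linear scale scale f"
  shows "((\<lambda>v. f v + v) ^^ n) v = (\<Sum>k\<le>n. scale (of_nat (n choose k)) ((f ^^ k) v))"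
proof (induction n)
  case 0
  then show ?case by simp
next
  case (Suc n)
  interpret f: Vector_Spaces.linear scale scale f
    by (fact lin)
  let ?t = "\<lambda>n k. scale (of_nat (n choose k)) ((f ^^ k) v)"
  have "((\<lambda>v. f v + v) ^^ Suc n) v = f (\<Sum>k\<le>n. ?t n k) + (\<Sum>k\<le>n. ?t n k)"
    by (simp add: Suc)
  also have "f (\<Sum>k\<le>n. ?t n k) = (\<Sum>k\<le>n. scale (of_nat (n choose k)) ((f ^^ Suc k) v))"
    by (simp add: f.sum f.scale)
  \<comment> \<open>The added term \<open>k = Suc n\<close> is zero; with it, shifting the index
    lines the two sums up for Pascal's rule.\<close>
  also have "(\<Sum>k\<le>n. ?t n k) = (\<Sum>k\<le>Suc n. ?t n k)"
    by (simp add: binomial_eq_0)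
  also have "\<dots> = v + (\<Sum>k\<le>n. ?t n (Suc k))"
    by (subst sum.atMost_Suc_shift) simp
  also have "(\<Sum>k\<le>n. scale (of_nat (n choose k)) ((f ^^ Suc k) v)) + (v + (\<Sum>k\<le>n. ?t n (Suc k)))
      = v + (\<Sum>k\<le>n. ?t (Suc n) (Suc k))"
    by (simp add: sum.distrib scale_left_distrib algebra_simps)
  also have "\<dots> = (\<Sum>k\<le>Suc n. ?t (Suc n) k)"
    by (subst sum.atMost_Suc_shift) simp
  finally show ?case .
qed

text \<open>With \<open>g = f - 1\<close>, the expansion of \<open>g + 1\<close> to the power
  \<open>p\<close> keeps only its two end terms, because \<open>p\<close> divides the inner binomial
  coefficients.\<close>

lemma funpow_prime_diff_id:
  assumes "prime p" and char: "of_nat p = (0 :: 'a)"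
    and lin: "Vector_Spaces.linear scale scale f"
  shows "((\<lambda>v. f v - v) ^^ p) v = (f ^^ p) v - v"
proof -
  let ?g = "\<lambda>v. f v - v"
  interpret f: Vector_Spaces.linear scale scale f
    by (fact lin)
  have g: "Vector_Spaces.linear scale scale ?g"
    using lin by unfold_locales (auto simp: f.add f.scale algebra_simps)
  have "scale (of_nat (p choose k)) ((?g ^^ k) v) = 0" if "k < p" "k \<noteq> 0" for k
  proof -
    have "p dvd p choose k"
      using dvd_choose_prime[of k p] that \<open>prime p\<close> by simp
    then have "of_nat (p choose k) = (0 :: 'a)"
      using char by (auto elim: dvdE)
    then show ?thesis by simp
  qed
  then have "(\<Sum>k = 1..<p. scale (of_nat (p choose k)) ((?g ^^ k) v)) = 0"
    by (intro sum.neutral) auto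
  moreover have "{..p} = insert 0 (insert p {1..<p})" "p > 0"
    using \<open>prime p\<close> by (auto simp: prime_gt_0_nat)
  ultimately have "(\<Sum>k\<le>p. scale (of_nat (p choose k)) ((?g ^^ k) v)) = v + (?g ^^ p) v"
    by simp
  then have "((\<lambda>v. ?g v + v) ^^ p) v = v + (?g ^^ p) v"
    using funpow_add_id[OF g] by simp
  then show ?thesis
    by simp
qed

text \<open>Each induction step applies the prime case to the linear map
  \<open>f ^^ (p ^ n)\<close>.\<close>

lemma funpow_prime_power_diff_id:
  assumes "prime p" and "of_nat p = (0 :: 'a)"
    and "Vector_Spaces.linear scale scale f"
  shows "((\<lambda>v. f v - v) ^^ (p ^ n)) v = (f ^^ (p ^ n)) v - v"
proof -
  have "(\<lambda>v. f v - v) ^^ (p ^ n) = (\<lambda>v. (f ^^ (p ^ n)) v - v)"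
  proof (induction n)
    case 0
    then show ?case by simp
  next
    case (Suc n)
    have "(\<lambda>v. f v - v) ^^ (p ^ Suc n) = (\<lambda>v. (f ^^ (p ^ n)) v - v) ^^ p"
      unfolding Suc[symmetric] by (simp add: funpow_mult mult.commute)
    then show ?case
      using funpow_prime_diff_id[OF assms(1,2) linear_funpow[OF assms(3)], of "p ^ n"]
      by (simp add: funpow_mult mult.commute fun_eq_iff)
  qed
  then show ?thesis
    by (rule fun_cong)
qed

end


section \<open>Groups\<close>

text \<open>The conjugacy classes partition the group and have cardinality a power of \<open>p\<close>, so the class
  of the unit cannot be the only singleton.\<close>

lemma (in group) p_group_exists_central:
  assumes "prime p" and ord: "Coset.order G = p ^ n" and "n > 0"
  shows "\<exists>z \<in> carrier G. z \<noteq> \<one> \<and> (\<forall>g \<in> carrier G. g \<otimes> z = z \<otimes> g)"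
proof (rule ccontr)
  assume no: "\<not> ?thesis"
  define c where "c = (\<lambda>g. \<lambda>h \<in> carrier G. g \<otimes> h \<otimes> inv g)"
  interpret c: group_action G "carrier G" c
    unfolding c_def by (rule action_by_conjugation)
  have "Coset.order G > 0"
    using ord prime_gt_0_nat[OF \<open>prime p\<close>] by simp
  then have fin: "finite (carrier G)"
    by (simp add: order_gt_0_iff_finite)
  have orbit_one: "orbit G c \<one> = {\<one>}"
    by (auto simp: orbit_def c_def intro: exI[of _ \<one>])
  have "p dvd card (orbit G c x)" if x: "x \<in> carrier G" "x \<noteq> \<one>" for x
  proof -
    have "card (orbit G c x) dvd p ^ n"
      using c.orbit_stabilizer_theorem[OF x(1)] ord by (metis dvd_triv_left)
    then obtain i where i: "card (orbit G c x) = p ^ i"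
      using divides_primepow_nat[OF \<open>prime p\<close>] by blast
    \<comment> \<open>A one-element class would make \<open>x\<close> central, against
      \<open>no\<close>.\<close>
    have "i \<noteq> 0"
    proof
      assume "i = 0"
      then obtain y where y: "orbit G c x = {y}"
        using i by (auto simp: card_1_singleton_iff)
      have "g \<otimes> x = x \<otimes> g" if g: "g \<in> carrier G" for g
      proof -
        have "c g x \<in> orbit G c x"
          using g by (auto simp: orbit_def)
        then have "g \<otimes> x \<otimes> inv g = x"
          using y c.orbit_refl[OF x(1)] x(1) by (simp add: c_def)
        then show ?thesis
          using g x(1) by (metis inv_solve_right' m_closed)
      qed
      then show False
        using no x by blast
    qed
    then show ?thesis
      using i by simp
  qed
  then have "p dvd card C" if "C \<in> orbits G (carrier G) c - {{\<one>}}" for C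
    using that orbit_one by (auto simp: orbits_def)
  then have "p dvd (\<Sum>C \<in> orbits G (carrier G) c - {{\<one>}}. card C)"
    by (rule dvd_sum)
  moreover have "Coset.order G = 1 + (\<Sum>C \<in> orbits G (carrier G) c - {{\<one>}}. card C)"
  proof -
    \<comment> \<open>The class equation, obtained by summing the constant 1 over the
      orbits.\<close>
    have "Coset.order G = (\<Sum>C \<in> orbits G (carrier G) c. card C)"
      using c.disjoint_sum[OF fin, of "\<lambda>_. 1 :: nat"] by (simp add: Coset.order_def)
    moreover have "{\<one>} \<in> orbits G (carrier G) c"
      using orbit_one by (auto simp: orbits_def intro!: exI[of _ \<one>])
    moreover have "finite (orbits G (carrier G) c)"
      using fin by (simp add: orbits_def)
    ultimately show ?thesis
      by (simp add: sum.remove[of _ "{\<one>}"])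
  qed
  moreover have "p dvd Coset.order G"
    using ord \<open>n > 0\<close> by simp
  ultimately have "p dvd 1"
    by (metis dvd_add_left_iff)
  then show False
    using \<open>prime p\<close> not_prime_1 by (metis dvd_1_iff_1 One_nat_def)
qed

text \<open>The projection from \<open>G Mod N\<close> onto \<open>G Mod M\<close>, written as
  multiplication of cosets by \<open>M\<close>, identifies the coset of \<open>z\<close> with the
  unit coset and so is not injective. This makes the index a decreasing measure for the later
  induction.\<close>

lemma (in group) order_FactGroup_less:
  assumes N: "N \<lhd> G" and M: "M \<lhd> G" and "N \<subseteq> M" and z: "z \<in> M" "z \<notin> N"
    and fin: "finite (carrier (G Mod N))"
  shows "Coset.order (G Mod M) < Coset.order (G Mod N)"
proof -
  interpret N: normal N G by fact
  interpret M: normal M G by fact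
  have zG: "z \<in> carrier G"
    using z(1) M.subset by blast
  have map: "M <#> (N #> x) = M #> x" if "x \<in> carrier G" for x
  proof -
    have "M <#> N = M"
    proof
      show "M <#> N \<subseteq> M"
        using \<open>N \<subseteq> M\<close> by (auto simp: set_mult_def)
      show "M \<subseteq> M <#> N"
        using M.subset by (force simp: set_mult_def intro: bexI[of _ \<one>])
    qed
    then show ?thesis
      using setmult_rcos_assoc[OF M.subset N.subset that] by simp
  qed
  have im: "carrier (G Mod M) = (<#>) M ` carrier (G Mod N)"
    using map by (force simp: FactGroup_def RCOSETS_def)
  have "\<not> inj_on ((<#>) M) (carrier (G Mod N))"
  proof
    assume "inj_on ((<#>) M) (carrier (G Mod N))"
    moreover have "M <#> (N #> z) = M <#> (N #> \<one>)"
      using map zG coset_join2[OF zG M.is_subgroup z(1)] M.subset by simp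
    moreover have "N #> z \<in> carrier (G Mod N)" "N #> \<one> \<in> carrier (G Mod N)"
      using rcosetsI[OF N.subset] zG by (auto simp: FactGroup_def simp del: coset_mult_one)
    ultimately have "N #> z = N #> \<one>"
      by (blast dest: inj_onD)
    then show False
      using rcos_self[OF zG N.is_subgroup] z(2) N.subset by simp
  qed
  then show ?thesis
    using fin im unfolding Coset.order_def by (metis card_image_le eq_card_imp_inj_on le_neq_implies_less)
qed

text \<open>If \<open>z\<close> is central modulo \<open>H\<close>, every conjugate of an element of
  \<open>H #> z\<close> stays in that coset. The generating set is therefore closed under
  conjugation.\<close>

lemma (in normal) normal_generate_central_coset:
  assumes z: "z \<in> carrier G"
    and central: "\<And>g. g \<in> carrier G \<Longrightarrow> (H #> g) <#> (H #> z) = (H #> z) <#> (H #> g)"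
  shows "generate G (H \<union> (H #> z)) \<lhd> G"
proof (rule normal_generateI)
  show "H \<union> (H #> z) \<subseteq> carrier G"
    using z subset r_coset_subset_G by auto
  fix h g assume h: "h \<in> H \<union> (H #> z)" and g: "g \<in> carrier G"
  show "g \<otimes> h \<otimes> inv g \<in> H \<union> (H #> z)"
  proof (cases "h \<in> H")
    case True
    then show ?thesis
      using inv_op_closed2[OF g] by blast
  next
    case False
    then have hz: "h \<in> H #> z"
      using h by blast
    then have hG: "h \<in> carrier G"
      using z subset r_coset_subset_G by blast
    have "H #> h = H #> z"
      using repr_independence[OF hz z is_subgroup] by simp
    then have "H #> (g \<otimes> h) = H #> (z \<otimes> g)"
      using central[OF g] rcos_sum g hG z by metis
    then have "(H #> (g \<otimes> h)) <#> (H #> inv g) = (H #> (z \<otimes> g)) <#> (H #> inv g)"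
      by simp
    then have "H #> (g \<otimes> h \<otimes> inv g) = H #> z"
      using rcos_sum g hG z by (simp add: m_assoc)
    then show ?thesis
      using rcos_self[OF _ is_subgroup] g hG by (metis UnI2 inv_closed m_closed)
  qed
qed


section \<open>Open subgroups\<close>

context topological_group
begin

lemma continuous_map_mult_right:
  assumes "a \<in> carrier G"
  shows "continuous_map T T (\<lambda>x. x \<otimes> a)"
proof -
  have "continuous_map T (prod_topology T T) (\<lambda>x. (x, a))"
    using assms topspace_eq by (intro continuous_map_pairedI) auto
  from continuous_map_compose[OF this continuous_mult] show ?thesis
    by (simp add: o_def)
qed

lemma continuous_map_mult_left:
  assumes "a \<in> carrier G"
  shows "continuous_map T T (\<lambda>x. a \<otimes> x)"
proof -
  have "continuous_map T (prod_topology T T) (\<lambda>x. (a, x))"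
    using assms topspace_eq by (intro continuous_map_pairedI) auto
  from continuous_map_compose[OF this continuous_mult] show ?thesis
    by (simp add: o_def)
qed

lemma continuous_map_conj:
  assumes "a \<in> carrier G"
  shows "continuous_map T T (\<lambda>x. a \<otimes> x \<otimes> inv a)"
  using continuous_map_compose[OF continuous_map_mult_left[OF assms]
      continuous_map_mult_right[OF inv_closed[OF assms]]]
  by (simp add: o_def)

lemma openin_r_coset:
  assumes U: "openin T U" and a: "a \<in> carrier G"
  shows "openin T (U #> a)"
proof -
  have sub: "U \<subseteq> carrier G"
    using openin_subset[OF U] topspace_eq by simp
  have "openin T {x \<in> topspace T. x \<otimes> inv a \<in> U}"
    using continuous_map_mult_right[OF inv_closed[OF a]] U by (rule openin_continuous_map_preimage)
  moreover have "{x \<in> topspace T. x \<otimes> inv a \<in> U} = U #> a"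
  proof
    show "{x \<in> topspace T. x \<otimes> inv a \<in> U} \<subseteq> U #> a"
    proof
      fix x assume x: "x \<in> {x \<in> topspace T. x \<otimes> inv a \<in> U}"
      then have "x = x \<otimes> inv a \<otimes> a"
        using a topspace_eq by (simp add: m_assoc)
      then show "x \<in> U #> a"
        using x unfolding r_coset_def by blast
    qed
    show "U #> a \<subseteq> {x \<in> topspace T. x \<otimes> inv a \<in> U}"
      using sub a topspace_eq by (auto simp: r_coset_def m_assoc)
  qed
  ultimately show ?thesis
    by simp
qed

text \<open>The larger subgroup is a union of translates of the open one.\<close>

lemma openin_subgroup_mono:
  assumes N: "subgroup N G" "openin T N" and M: "subgroup M G" and "N \<subseteq> M"
  shows "openin T M"
proof -
  have MG: "M \<subseteq> carrier G"
    using M by (rule subgroup.subset)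
  have "M = (\<Union>m\<in>M. N #> m)"
  proof
    show "M \<subseteq> (\<Union>m\<in>M. N #> m)"
      using rcos_self[OF _ N(1)] MG by blast
    show "(\<Union>m\<in>M. N #> m) \<subseteq> M"
      using \<open>N \<subseteq> M\<close> subgroup.m_closed[OF M] by (auto simp: r_coset_def)
  qed
  moreover have "openin T (\<Union>m\<in>M. N #> m)"
    using openin_r_coset[OF N(2)] MG by blast
  ultimately show ?thesis
    by simp
qed

text \<open>\<open>N\<close> is the normal core of \<open>U\<close>. By compactness \<open>U\<close>
  has finitely many cosets, and conjugates of \<open>U\<close> by elements of one coset
  \<open>U #> r\<close> impose the same condition, so the core is a finite intersection of open
  sets.\<close>

lemma exists_open_normal_subgroup:
  assumes comp: "compact_space T" and U: "subgroup U G" "openin T U"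
  shows "\<exists>N. N \<lhd> G \<and> openin T N \<and> N \<subseteq> U"
proof -
  have "\<exists>\<F>. finite \<F> \<and> \<F> \<subseteq> rcosets U \<and> topspace T \<subseteq> \<Union>\<F>"
    using comp openin_r_coset[OF U(2)] rcosets_part_G[OF U(1)] topspace_eq
    unfolding compact_space_alt by (simp add: RCOSETS_def)
  then obtain \<F> where \<F>: "finite \<F>" "\<F> \<subseteq> rcosets U" "carrier G \<subseteq> \<Union>\<F>"
    using topspace_eq by auto
  have "rcosets U = (\<lambda>r. U #> r) ` carrier G"
    by (auto simp: RCOSETS_def)
  then obtain R where R: "R \<subseteq> carrier G" "finite R" "\<F> = (\<lambda>r. U #> r) ` R"
    using finite_subset_image[OF \<F>(1)] \<F>(2) by metis
  define N where "N = {x \<in> carrier G. \<forall>g\<in>carrier G. g \<otimes> x \<otimes> inv g \<in> U}"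
  have mem: "g \<otimes> x \<otimes> inv g \<in> U"
    if x: "x \<in> carrier G" "\<forall>r\<in>R. r \<otimes> x \<otimes> inv r \<in> U" and g: "g \<in> carrier G" for x g
  proof -
    obtain r u where ru: "r \<in> R" "u \<in> U" "g = u \<otimes> r"
      using \<F>(3) R(3) g by (force simp: r_coset_def)
    have carr: "r \<in> carrier G" "u \<in> carrier G"
      using ru R(1) subgroup.subset[OF U(1)] by auto
    have "g \<otimes> x \<otimes> inv g = u \<otimes> (r \<otimes> x \<otimes> inv r) \<otimes> inv u"
      using carr x(1) ru(3) by (simp add: m_assoc inv_mult_group)
    then show ?thesis
      using x(2) ru U(1) by (simp add: subgroup.m_closed subgroup.m_inv_closed)
  qed
  \<comment> \<open>The factor \<open>topspace T\<close> keeps the equation valid for empty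
    \<open>R\<close>, where the inner intersection is \<open>UNIV\<close>.\<close>
  have "N = topspace T \<inter> (\<Inter>r\<in>R. {x \<in> topspace T. r \<otimes> x \<otimes> inv r \<in> U})"
    using mem R(1) topspace_eq by (auto simp: N_def)
  moreover have "openin T (topspace T \<inter> (\<Inter>r\<in>R. {x \<in> topspace T. r \<otimes> x \<otimes> inv r \<in> U}))"
    using R continuous_map_conj U(2)
    by (cases "R = {}")
      (auto intro!: openin_Int openin_INT2 openin_continuous_map_preimage)
  ultimately have "openin T N"
    by simp
  moreover have "N \<lhd> G"
    unfolding normal_inv_iff
  proof (intro conjI ballI)
    show "subgroup N G"
    proof (rule subgroupI)
      show "N \<subseteq> carrier G" "N \<noteq> {}"
        using subgroup.one_closed[OF U(1)] by (auto simp: N_def intro!: exI[of _ \<one>])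
    next
      fix x assume x: "x \<in> N"
      have "g \<otimes> inv x \<otimes> inv g = inv (g \<otimes> x \<otimes> inv g)" if "g \<in> carrier G" for g
        using that x by (simp add: N_def m_assoc inv_mult_group)
      then show "inv x \<in> N"
        using x subgroup.m_inv_closed[OF U(1)] by (simp add: N_def)
    next
      fix x y assume x: "x \<in> N" and y: "y \<in> N"
      have "g \<otimes> (x \<otimes> y) \<otimes> inv g = (g \<otimes> x \<otimes> inv g) \<otimes> (g \<otimes> y \<otimes> inv g)" if "g \<in> carrier G" for g
      proof -
        have "inv g \<otimes> (g \<otimes> (y \<otimes> inv g)) = y \<otimes> inv g"
          using that y by (simp add: N_def m_assoc[symmetric])
        then show ?thesis
          using that x y by (simp add: N_def m_assoc)
      qed
      then show "x \<otimes> y \<in> N"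
        using x y subgroup.m_closed[OF U(1)] by (simp add: N_def)
    qed
    fix a x assume a: "a \<in> carrier G" and x: "x \<in> N"
    have "g \<otimes> (a \<otimes> x \<otimes> inv a) \<otimes> inv g = (g \<otimes> a) \<otimes> x \<otimes> inv (g \<otimes> a)" if "g \<in> carrier G" for g
      using that a x by (simp add: N_def m_assoc inv_mult_group)
    then show "a \<otimes> x \<otimes> inv a \<in> N"
      using a x by (simp add: N_def)
  qed
  moreover have "N \<subseteq> U"
    by (auto simp: N_def dest: bspec[OF _ one_closed])
  ultimately show ?thesis
    by blast
qed

end


section \<open>Fixed spaces\<close>

lemma fixed_space_antimono: "K \<subseteq> L \<Longrightarrow> fixed_space \<pi> L \<subseteq> fixed_space \<pi> K"
  by (auto simp: fixed_space_def)

context representation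
begin

lemma vector_space_smul: "vector_space smul"
  using linear[OF group.is_monoid[THEN monoid.one_closed]] group_hom
  by (simp add: Vector_Spaces.linear_def group_hom_def)

sublocale vector_space smul
  by (rule vector_space_smul)

lemma subspace_fixed_space:
  assumes "K \<subseteq> carrier G"
  shows "subspace (fixed_space \<pi> K)"
proof -
  have "\<pi> k 0 = 0" "\<pi> k (x + y) = \<pi> k x + \<pi> k y" "\<pi> k (smul c x) = smul c (\<pi> k x)"
    if "k \<in> K" for k c x y
  proof -
    interpret f: Vector_Spaces.linear smul smul "\<pi> k"
      using linear assms that by blast
    show "\<pi> k 0 = 0" "\<pi> k (x + y) = \<pi> k x + \<pi> k y" "\<pi> k (smul c x) = smul c (\<pi> k x)"
      by (simp_all add: f.zero f.add f.scale)
  qed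
  then show ?thesis
    unfolding subspace_def fixed_space_def by simp
qed

text \<open>The stabilizer of a vector is a subgroup, so it contains \<open>generate G S\<close> as
  soon as it contains \<open>S\<close>.\<close>

lemma fixed_space_generate:
  assumes "S \<subseteq> carrier G"
  shows "fixed_space \<pi> (generate G S) = fixed_space \<pi> S"
proof
  interpret group G
    using group_hom by (simp add: group_hom_def)
  show "fixed_space \<pi> (generate G S) \<subseteq> fixed_space \<pi> S"
    by (intro fixed_space_antimono) (auto intro: generate.incl)
  show "fixed_space \<pi> S \<subseteq> fixed_space \<pi> (generate G S)"
  proof
    fix v assume "v \<in> fixed_space \<pi> S"
    then have "S \<subseteq> stabilizer G \<pi> v"
      using assms by (auto simp: fixed_space_def stabilizer_def)
    then have "generate G S \<subseteq> stabilizer G \<pi> v"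
      using generate_subgroup_incl stabilizer_subgroup by blast
    then show "v \<in> fixed_space \<pi> (generate G S)"
      by (auto simp: fixed_space_def stabilizer_def)
  qed
qed

text \<open>Moving \<open>n\<close> past \<open>g\<close> replaces it by its conjugate
  \<open>inv g \<otimes> n \<otimes> g\<close>, which is again in \<open>N\<close> and fixes
  \<open>v\<close>.\<close>

lemma fixed_space_normal_invariant:
  assumes "N \<lhd> G" and g: "g \<in> carrier G" and v: "v \<in> fixed_space \<pi> N"
  shows "\<pi> g v \<in> fixed_space \<pi> N"
proof -
  interpret N: normal N G by fact
  have "\<pi> n (\<pi> g v) = \<pi> g v" if n: "n \<in> N" for n
  proof -
    have nG: "n \<in> carrier G"
      using n N.subset by blast
    have "\<pi> n (\<pi> g v) = \<pi> (g \<otimes> (inv g \<otimes> n \<otimes> g)) v"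
      using composition_rule[of v n g] g nG by (simp add: N.m_assoc[symmetric])
    also have "\<dots> = \<pi> g (\<pi> (inv g \<otimes> n \<otimes> g) v)"
      using g nG by (intro composition_rule) auto
    also have "\<dots> = \<pi> g v"
      using v N.inv_op_closed1[OF g n] by (simp add: fixed_space_def)
    finally show ?thesis .
  qed
  then show ?thesis
    by (simp add: fixed_space_def)
qed

lemma funpow_action:
  assumes "g \<in> carrier G"
  shows "(\<pi> g ^^ n) v = \<pi> (g [^] (n :: nat)) v"
proof -
  interpret group G
    using group_hom by (simp add: group_hom_def)
  show ?thesis
  proof (induction n)
    case 0
    then show ?case
      using fun_cong[OF id_eq_one, of v] by simp
  next
    case (Suc n)
    then show ?case
      using assms composition_rule[of v g "g [^] n"] nat_pow_Suc2[OF assms, of n] by simp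
  qed
qed

end

text \<open>Climbing from \<open>N\<close> to \<open>M = \<langle>N, z\<rangle>\<close> with \<open>z\<close> central modulo \<open>N\<close>: on the fixed space of \<open>N\<close> the
  operator \<open>z - 1\<close> has the fixed space of \<open>M\<close> as kernel, and it is nilpotent because
  \<open>(z - 1)\<^sup>q = z\<^sup>q - 1 = 0\<close> for \<open>q\<close> the index of \<open>N\<close>.\<close>

lemma finite_dimensional_fixed_space_normal:
  fixes smul :: "'k::field \<Rightarrow> 'v::ab_group_add \<Rightarrow> 'v"
  assumes "pro_p_group G T p" and "representation G smul \<pi>" and char: "of_nat p = (0 :: 'k)"
    and fin: "finite_dimensional_subspace smul (fixed_space \<pi> (carrier G))"
    and "N \<lhd> G" and "openin T N"
  shows "finite_dimensional_subspace smul (fixed_space \<pi> N)"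
  using assms(5,6)
proof (induction "Coset.order (G Mod N)" arbitrary: N rule: less_induct)
  case less
  interpret pro_p_group G T p by fact
  interpret representation G smul \<pi> by fact
  interpret N: normal N G by fact
  interpret Q: group "G Mod N" by (rule N.factorgroup_is_group)
  obtain n where n: "Coset.order (G Mod N) = p ^ n"
    using quotient_p_group less.prems by blast
  have coset_carrier: "N #>\<^bsub>G\<^esub> x \<in> carrier (G Mod N)" if "x \<in> carrier G" for x
    using that N.subset by (auto simp: FactGroup_def intro: rcosetsI)
  have coset_eqD: "x \<in> N" if "x \<in> carrier G" "N #>\<^bsub>G\<^esub> x = \<one>\<^bsub>G Mod N\<^esub>" for x
    using that rcos_self[OF that(1) N.is_subgroup] by (simp add: FactGroup_def)
  show ?case
  \<comment> \<open>For \<open>n = 0\<close> the index is 1, so \<open>N\<close> is the whole group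
    and the hypothesis \<open>fin\<close> applies.\<close>
  proof (cases "n = 0")
    case True
    then have "card (carrier (G Mod N)) = 1"
      using n by (simp add: Coset.order_def)
    then have "x \<in> N" if "x \<in> carrier G" for x
      using that coset_carrier[OF that] Q.one_closed coset_eqD
      by (metis card_1_singletonE singletonD)
    then have "N = carrier G"
      using N.subset by blast
    then show ?thesis
      using fin by simp
  next
    case False
    then obtain Z where Z: "Z \<in> carrier (G Mod N)" "Z \<noteq> \<one>\<^bsub>G Mod N\<^esub>"
        "\<And>C. C \<in> carrier (G Mod N) \<Longrightarrow> C \<otimes>\<^bsub>G Mod N\<^esub> Z = Z \<otimes>\<^bsub>G Mod N\<^esub> C"
      using Q.p_group_exists_central[OF prime_p n] by blast
    obtain z where z: "z \<in> carrier G" "Z = N #>\<^bsub>G\<^esub> z"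
      using Z(1) by (auto simp: FactGroup_def RCOSETS_def)
    have "z \<notin> N"
      using Z(2) z coset_join2[OF z(1) N.is_subgroup] by (auto simp: FactGroup_def)
    \<comment> \<open>The whole coset is adjoined, not just \<open>z\<close>: conjugation preserves
      \<open>z\<close> only modulo \<open>N\<close>.\<close>
    define S where "S = N \<union> (N #>\<^bsub>G\<^esub> z)"
    define M where "M = generate G S"
    have SG: "S \<subseteq> carrier G"
      using z(1) N.subset r_coset_subset_G by (auto simp: S_def)
    have SM: "S \<subseteq> M"
      by (auto simp: M_def intro: generate.incl)
    then have NM: "N \<subseteq> M"
      by (auto simp: S_def)
    have zM: "z \<in> M"
      using SM rcos_self[OF z(1) N.is_subgroup] by (auto simp: S_def)
    have M: "M \<lhd> G"
      unfolding M_def S_def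
      using N.normal_generate_central_coset[OF z(1)] Z(3)[OF coset_carrier] z(2)
      by (simp add: FactGroup_def)
    have "openin T M"
      using openin_subgroup_mono[OF N.is_subgroup less.prems(2)] M NM
      by (simp add: normal_imp_subgroup)
    moreover have "finite (carrier (G Mod N))"
      using n prime_gt_0_nat[OF prime_p] by (metis Q.order_gt_0_iff_finite zero_less_power)
    then have "Coset.order (G Mod M) < Coset.order (G Mod N)"
      using order_FactGroup_less[OF less.prems(1) M NM zM \<open>z \<notin> N\<close>] by blast
    ultimately have fin_M: "finite_dimensional_subspace smul (fixed_space \<pi> M)"
      using less.hyps M by blast
    show ?thesis
    proof (rule finite_dimensional_subspace_nilpotent)
      interpret f: Vector_Spaces.linear smul smul "\<pi> z"
        using linear[OF z(1)] .
      show "Vector_Spaces.linear smul smul (\<lambda>v. \<pi> z v - v)"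
        by unfold_locales (auto simp: f.add f.scale algebra_simps)
      show sub: "subspace (fixed_space \<pi> N)"
        using N.subset by (rule subspace_fixed_space)
      show "\<pi> z v - v \<in> fixed_space \<pi> N" if "v \<in> fixed_space \<pi> N" for v
        using fixed_space_normal_invariant[OF less.prems(1) z(1) that] that
        by (rule subspace_diff[OF sub])
      have "{v \<in> fixed_space \<pi> N. \<pi> z v - v = 0} = fixed_space \<pi> M"
      proof
        show "fixed_space \<pi> M \<subseteq> {v \<in> fixed_space \<pi> N. \<pi> z v - v = 0}"
          using NM zM by (auto simp: fixed_space_def)
        show "{v \<in> fixed_space \<pi> N. \<pi> z v - v = 0} \<subseteq> fixed_space \<pi> M"
        proof
          fix v assume v: "v \<in> {v \<in> fixed_space \<pi> N. \<pi> z v - v = 0}"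
          have "\<pi> (h \<otimes>\<^bsub>G\<^esub> z) v = v" if "h \<in> N" for h
            using v that z(1) N.subset composition_rule[of v h z] by (auto simp: fixed_space_def)
          then have "v \<in> fixed_space \<pi> S"
            using v by (auto simp: fixed_space_def S_def r_coset_def)
          then show "v \<in> fixed_space \<pi> M"
            using fixed_space_generate[OF SG] by (simp add: M_def)
        qed
      qed
      then show "finite_dimensional_subspace smul {v \<in> fixed_space \<pi> N. \<pi> z v - v = 0}"
        using fin_M by simp
      show "((\<lambda>v. \<pi> z v - v) ^^ (p ^ n)) v = 0" if "v \<in> fixed_space \<pi> N" for v
      proof -
        have "N #>\<^bsub>G\<^esub> (z [^]\<^bsub>G\<^esub> (p ^ n)) = \<one>\<^bsub>G Mod N\<^esub>"
          using Q.pow_order_eq_1[OF Z(1)] n N.FactGroup_pow[OF z(1)] z(2) by simp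
        then have "z [^]\<^bsub>G\<^esub> (p ^ n) \<in> N"
          using coset_eqD z(1) by simp
        then show ?thesis
          using funpow_prime_power_diff_id[OF prime_p char linear[OF z(1)]]
            funpow_action[OF z(1)] that
          by (simp add: fixed_space_def)
      qed
    qed
  qed
qed

section \<open>From open normal subgroups of P to all open subgroups\<close>

theorem lemma6p18:
  fixes G :: "('g, 'm) monoid_scheme"
    and T :: "'g topology"
    and P :: "'g set"
    and smul :: "'p::prime_card Fp_bar \<Rightarrow> 'v::ab_group_add \<Rightarrow> 'v"
    and \<pi> :: "'g \<Rightarrow> 'v \<Rightarrow> 'v"
  assumes "locally_profinite_group G T"
    and "subgroup P G" and "openin T P"
    and "pro_p_group (G\<lparr>carrier := P\<rparr>) (subtopology T P) (CARD('p))"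
    and "smooth_representation G smul \<pi> T"
  shows "admissible_representation G smul \<pi> T \<longleftrightarrow>
    finite_dimensional_subspace smul (fixed_space \<pi> P)"
proof
  assume "admissible_representation G smul \<pi> T"
  then show "finite_dimensional_subspace smul (fixed_space \<pi> P)"
    using assms(2,3) by (simp add: admissible_representation_def)
next
  assume fin: "finite_dimensional_subspace smul (fixed_space \<pi> P)"
  interpret locally_profinite_group G T by fact
  interpret smooth_representation G smul \<pi> T by fact
  interpret P: pro_p_group "G\<lparr>carrier := P\<rparr>" "subtopology T P" "CARD('p)" by fact
  have rep: "Defs.representation (G\<lparr>carrier := P\<rparr>) smul \<pi>"
    using induced_action[OF assms(2)] linear subgroup.subset[OF assms(2)]
    by (auto simp: Defs.representation_def representation_axioms_def)
  \<comment> \<open>The equation holds in the prime field and is carried along its embedding into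
    the algebraic closure.\<close>
  have char: "of_nat CARD('p) = (0 :: 'p Fp_bar)"
    by (metis of_nat_card_eq_0 to_ac_0 to_ac_of_nat)
  have "finite_dimensional_subspace smul (fixed_space \<pi> K)"
    if K: "subgroup K G" "openin T K" for K
  proof -
    \<comment> \<open>\<open>K\<close> need not lie in \<open>P\<close>; the intersection is an open
      subgroup of the compact group \<open>P\<close>, so it contains an open normal subgroup of
      \<open>P\<close>.\<close>
    have "subgroup (K \<inter> P) (G\<lparr>carrier := P\<rparr>)"
      using K(1) assms(2) by (simp add: subgroups_Inter_pair subgroup_incl)
    moreover have "openin (subtopology T P) (K \<inter> P)"
      using K(2) by (auto simp: openin_subtopology)
    ultimately obtain N where N: "N \<lhd> G\<lparr>carrier := P\<rparr>" "openin (subtopology T P) N" "N \<subseteq> K \<inter> P"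
      using P.exists_open_normal_subgroup[OF P.compact] by blast
    have "finite_dimensional_subspace smul (fixed_space \<pi> N)"
      using finite_dimensional_fixed_space_normal[OF assms(4) rep char _ N(1,2)] fin by simp
    then show ?thesis
      using finite_dimensional_subspace_mono subspace_fixed_space[OF subgroup.subset[OF K(1)]]
        fixed_space_antimono[of N K \<pi>] N(3) by blast
  qed
  then show "admissible_representation G smul \<pi> T"
    using assms(5) by (simp add: admissible_representation_def)
qed

end
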